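(* For any integers $d\ge 1$ and $M\geq 3$: (i) $\Lambda_d(M) \subsetneq \Gamma_{FSA}(M)$; (ii) $\Lambda_d(M)$ and $\Gamma_{SM}(M)$ have nonempty intersection, but neither is a subset of the other.
   Context: Write $[M]=\{1,\dots,M\}$, $\mathbb{R}_+=[0,\infty)$, and $|A|$ for the $d$-dimensional Lebesgue measure of a compact set $A\subset\mathbb{R}^d$. Sums of sets are Minkowski sums. For an $M$-tuple $\mathbf{A}=(A_1,\dots,A_M)$ of nonempty compact subsets of $\mathbb{R}^d$, define the set function $\nu_{\mathbf{A}}:2^{[M]}\to\mathbb{R}_+$ by $\nu_{\mathbf{A}}(\emptyset)=0$ and $\nu_{\mathbf{A}}(S)=\left|\sum_{i\in S}A_i\right|$ for nonempty $S\subset[M]$. The $(d,M)$-Lyusternik region is $$\Lambda_d(M)=\{\nu_{\mathbf{A}} : \mathbf{A}=(A_1,\dots,A_M),\ A_i \text{ a nonempty compact subset of } \mathbb{R}^d \text{ for each } i\}.$$ A fractional partition $(\mathcal{G},\beta)$ of a set $T$ is a collection $\mathcal{G}$ of subsets of $T$ together with a weight function $\beta:\mathcal{G}\to\mathbb{R}_+$, $S\mapsto\beta_S$, such that $\sum_{S\in\mathcal{G}:\, i\in S}\beta_S=1$ for each $i\in T$. A set function $v:2^{[M]}\to\mathbb{R}_+$ is fractionally superadditive if for every subset $T\subset[M]$ and every fractional partition $(\mathcal{G},\beta)$ of $T$, $v(T)\ge\sum_{S\in\mathcal{G}}\beta_S v(S)$. $\Gamma_{FSA}(M)$ is the class of all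 fractionally superadditive $v:2^{[M]}\to\mathbb{R}_+$ with $v(\emptyset)=0$. A set function $v:2^{[M]}\to\mathbb{R}_+$ is supermodular if $v(S\cup T)+v(S\cap T)\ge v(S)+v(T)$ for all $S,T\subset[M]$. $\Gamma_{SM}(M)$ is the class of all supermodular $v:2^{[M]}\to\mathbb{R}_+$ with $v(\emptyset)=0$. *)

theory Defs
  imports "HOL-Analysis.Analysis" "HOL-Library.Set_Algebras"
begin

text \<open>
  A set function \<open>2\<^sup>[\<^sup>M\<^sup>] \<rightarrow> \<real>\<^sub>+\<close> is an element of \<open>Pow {1..M} \<rightarrow>\<^sub>E {0..}\<close>. The extensional
  function space is used so that equality in HOL is equality on the subsets of \<open>{1..M}\<close>.
\<close>

definition set_functions :: "nat \<Rightarrow> (nat set \<Rightarrow> real) set" where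
  "set_functions M = Pow {1..M} \<rightarrow>\<^sub>E {0..}"

text \<open>
  The sum of sets below is the Minkowski sum of \<open>HOL-Library.Set_Algebras\<close>. The dimension is
  \<open>CARD('n)\<close>, which is an arbitrary positive integer.
\<close>

definition sumset_volume :: "nat \<Rightarrow> (nat \<Rightarrow> (real ^ 'n) set) \<Rightarrow> nat set \<Rightarrow> real" where
  "sumset_volume M A =
     (\<lambda>S\<in>Pow {1..M}. if S = {} then 0 else measure lebesgue (\<Sum>i\<in>S. A i))"

definition lyusternik_region :: "'n::finite itself \<Rightarrow> nat \<Rightarrow> (nat set \<Rightarrow> real) set" where
  "lyusternik_region _ M =
     {sumset_volume M A | A :: nat \<Rightarrow> (real ^ 'n) set.
        \<forall>i\<in>{1..M}. compact (A i) \<and> A i \<noteq> {}}"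

definition fractional_partition :: "'a set \<Rightarrow> 'a set set \<Rightarrow> ('a set \<Rightarrow> real) \<Rightarrow> bool" where
  "fractional_partition T G \<beta> \<longleftrightarrow>
     G \<subseteq> Pow T \<and> (\<forall>S\<in>G. \<beta> S \<ge> 0) \<and> (\<forall>i\<in>T. (\<Sum>S\<in>{S\<in>G. i \<in> S}. \<beta> S) = 1)"

definition fractionally_superadditive :: "nat \<Rightarrow> (nat set \<Rightarrow> real) \<Rightarrow> bool" where
  "fractionally_superadditive M v \<longleftrightarrow>
     (\<forall>T G \<beta>. T \<subseteq> {1..M} \<longrightarrow> fractional_partition T G \<beta> \<longrightarrow> v T \<ge> (\<Sum>S\<in>G. \<beta> S * v S))"

definition supermodular :: "nat \<Rightarrow> (nat set \<Rightarrow> real) \<Rightarrow> bool" where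
  "supermodular M v \<longleftrightarrow>
     (\<forall>S T. S \<subseteq> {1..M} \<longrightarrow> T \<subseteq> {1..M} \<longrightarrow> v (S \<union> T) + v (S \<inter> T) \<ge> v S + v T)"

definition Gamma_FSA :: "nat \<Rightarrow> (nat set \<Rightarrow> real) set" where
  "Gamma_FSA M = {v \<in> set_functions M. fractionally_superadditive M v \<and> v {} = 0}"

definition Gamma_SM :: "nat \<Rightarrow> (nat set \<Rightarrow> real) set" where
  "Gamma_SM M = {v \<in> set_functions M. supermodular M v \<and> v {} = 0}"

end

theory Submission
  imports Defs
begin

text \<open>
  Fractional superadditivity follows from core elements: if every \<open>T\<close> carries weights
  \<open>g\<close> with \<open>v T = (\<Sum>j\<in>T. g j)\<close> and \<open>v S \<le> (\<Sum>j\<in>S. g j)\<close> for all \<open>S \<subseteq> T\<close>, then summing over a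
  fractional partition and exchanging the order of summation gives the inequality
  (\<open>fractional_partition_sum_le_core\<close>).

  For volumes of Minkowski sums the core element is geometric (\<open>Minkowski_sum_core\<close>). Write
  \<open>A\<^sub>S\<close> for the sum of the \<open>A i\<close> over \<open>S\<close>, fix a direction \<open>u\<close>, and
  cut \<open>A\<^sub>T\<close> by hyperplanes orthogonal to \<open>u\<close> into one slab for each
  \<open>j \<in> T\<close>, whose thickness is the width of \<open>A j\<close> in direction \<open>u\<close>; let \<open>g j\<close> be the volume of
  \<open>A\<^sub>T\<close> in the slab of \<open>j\<close>. The sum \<open>A\<^sub>S\<close> is cut in the same way. Its slab of \<open>j\<close>
  is carried into that of \<open>A\<^sub>T\<close> by translation with a suitable point of \<open>A\<^sub>T\<^sub>-\<^sub>S\<close>, made from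
  highest points of the \<open>A i\<close> with \<open>i < j\<close> and lowest points of those with \<open>i > j\<close>. So the volume of
  \<open>A\<^sub>S\<close> is at most the sum of \<open>g j\<close> over \<open>j \<in> S\<close>, in every dimension.

  A single set function separates both other classes from the Lyusternik region: the sum of the
  indicators of \<open>1 \<in> S\<close> and of \<open>{2, 3} \<subseteq> S\<close>. It is supermodular and has core elements. If it came
  from compact sets, then \<open>A 1\<close> would have positive volume and adding \<open>A 2\<close> to it would not increase
  that volume, which forces \<open>A 2\<close> to be a point (\<open>measure_set_plus_gt\<close>); but adding a point to
  \<open>A 3\<close> cannot raise its volume from 0 to 1.

  Conversely, sumset volumes need not be supermodular. On the line, \<open>{0, 1}\<close> with two copies of
  \<open>[0, 1]\<close> violates the inequality, since \<open>3 + 0 < 2 + 2\<close>; multiplying only \<open>{0, 1}\<close> by a unit cube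
  of the remaining coordinates gives the same numbers in any dimension.
\<close>

section \<open>Cores and fractional superadditivity\<close>

text \<open>
  The easy direction of the Bondareva--Shapley theorem. The total weight \<open>\<beta>\<close> of the sets
  containing \<open>j\<close> is 1, so double counting charges each \<open>g j\<close> exactly once.
\<close>

lemma fractional_partition_sum_le_core:
  fixes g :: "'a \<Rightarrow> real"
  assumes "finite T" and fp: "fractional_partition T G \<beta>"
    and dom: "\<And>S. S \<subseteq> T \<Longrightarrow> v S \<le> sum g S"
  shows "(\<Sum>S\<in>G. \<beta> S * v S) \<le> sum g T"
proof -
  have G: "G \<subseteq> Pow T" and nn: "\<And>S. S \<in> G \<Longrightarrow> \<beta> S \<ge> 0"
    and one: "\<And>i. i \<in> T \<Longrightarrow> (\<Sum>S\<in>{S\<in>G. i \<in> S}. \<beta> S) = 1"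
    using fp by (auto simp: fractional_partition_def)
  have finG: "finite G"
    using G \<open>finite T\<close> by (meson finite_Pow_iff finite_subset)
  have "(\<Sum>S\<in>G. \<beta> S * v S) \<le> (\<Sum>S\<in>G. \<beta> S * sum g S)"
    using G nn dom by (intro sum_mono mult_left_mono) auto
  also have "\<dots> = (\<Sum>S\<in>G. \<Sum>j\<in>{j\<in>T. j \<in> S}. \<beta> S * g j)"
  proof (intro sum.cong refl)
    fix S assume "S \<in> G"
    then have "{j\<in>T. j \<in> S} = S" using G by auto
    then show "\<beta> S * sum g S = (\<Sum>j\<in>{j\<in>T. j \<in> S}. \<beta> S * g j)"
      by (simp add: sum_distrib_left)
  qed
  also have "\<dots> = (\<Sum>j\<in>T. \<Sum>S\<in>{S\<in>G. j \<in> S}. \<beta> S * g j)"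
    by (rule sum.swap_restrict[OF finG \<open>finite T\<close>])
  also have "\<dots> = (\<Sum>j\<in>T. (\<Sum>S\<in>{S\<in>G. j \<in> S}. \<beta> S) * g j)"
    by (simp add: sum_distrib_right)
  also have "\<dots> = sum g T"
    using one by simp
  finally show ?thesis .
qed

lemma fractionally_superadditive_if_cores:
  assumes "\<And>T. T \<subseteq> {1..M} \<Longrightarrow> \<exists>g. sum g T = v T \<and> (\<forall>S\<subseteq>T. v S \<le> sum g S)"
  shows "fractionally_superadditive M v"
  unfolding fractionally_superadditive_def
proof (intro allI impI)
  fix T G \<beta> assume T: "T \<subseteq> {1..M}" and fp: "fractional_partition T G \<beta>"
  obtain g where "sum g T = v T" "\<forall>S\<subseteq>T. v S \<le> sum g S"
    using assms[OF T] by blast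
  moreover have "finite T" using T finite_subset by blast
  ultimately show "(\<Sum>S\<in>G. \<beta> S * v S) \<le> v T"
    using fractional_partition_sum_le_core[OF _ fp, of v g] by auto
qed

section \<open>Minkowski sums of compact sets\<close>

lemma compact_set_plus:
  fixes A B :: "'a::real_normed_vector set"
  assumes "compact A" "compact B"
  shows "compact (A + B)"
proof -
  have "A + B = {x + y | x y. x \<in> A \<and> y \<in> B}"
    by (auto simp: set_plus_def)
  then show ?thesis using compact_sums[OF assms] by simp
qed

lemma compact_set_sum:
  fixes A :: "'i \<Rightarrow> 'a::real_normed_vector set"
  assumes "finite I" "\<And>i. i \<in> I \<Longrightarrow> compact (A i)"
  shows "compact (\<Sum>i\<in>I. A i)"
  using assms by (induction I) (auto simp: compact_set_plus)

lemma lmeasurable_Int_halfspace: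
  fixes K :: "'a::euclidean_space set"
  assumes "compact K"
  shows "K \<inter> {x. u \<bullet> x \<le> c} \<in> lmeasurable"
  using assms by (intro lmeasurable_compact compact_Int_closed closed_halfspace_le)

section \<open>Slicing a Minkowski sum into slabs\<close>

text \<open>
  The slab argument. Order the indices as numbers and move along direction \<open>u\<close> through \<open>A\<^sub>S\<close> by
  switching one summand after the other from its lowest point to its highest. The heights
  reached, \<open>L S j\<close> below, are the cut levels: step \<open>j\<close> raises the level by the width of \<open>A j\<close> if
  \<open>j \<in> S\<close>, and not at all otherwise. Levels are additive in \<open>S\<close>, so adding the points
  that represent \<open>T - S\<close> at step \<open>j\<close> moves the \<open>j\<close>-th slab of \<open>A\<^sub>S\<close> exactly to the height of the
  \<open>j\<close>-th slab of \<open>A\<^sub>T\<close>.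
\<close>

lemma Minkowski_sum_core:
  fixes A :: "nat \<Rightarrow> 'a::euclidean_space set"
  assumes "finite T" and cmp: "\<And>i. i \<in> T \<Longrightarrow> compact (A i)"
    and ne: "\<And>i. i \<in> T \<Longrightarrow> A i \<noteq> {}"
  shows "\<exists>g. (\<Sum>j\<in>T. g j) = measure lebesgue (\<Sum>i\<in>T. A i) \<and>
             (\<forall>S\<subseteq>T. measure lebesgue (\<Sum>i\<in>S. A i) \<le> (\<Sum>j\<in>S. g j))"
proof -
  obtain u :: 'a where "u \<in> Basis" using nonempty_Basis by blast
  then have u: "u \<noteq> 0" by auto
  have ex: "\<exists>l h. l \<in> A i \<and> h \<in> A i \<and> (\<forall>x\<in>A i. u \<bullet> l \<le> u \<bullet> x \<and> u \<bullet> x \<le> u \<bullet> h)"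
    if "i \<in> T" for i
  proof -
    have c: "continuous_on (A i) (\<lambda>x. u \<bullet> x)" by (intro continuous_intros)
    show ?thesis
      using continuous_attains_inf[OF cmp[OF that] ne[OF that] c]
        continuous_attains_sup[OF cmp[OF that] ne[OF that] c] by blast
  qed
  obtain lo hi where lo: "\<And>i. i \<in> T \<Longrightarrow> lo i \<in> A i" and hi: "\<And>i. i \<in> T \<Longrightarrow> hi i \<in> A i"
    and lo_le: "\<And>i x. i \<in> T \<Longrightarrow> x \<in> A i \<Longrightarrow> u \<bullet> lo i \<le> u \<bullet> x"
    and le_hi: "\<And>i x. i \<in> T \<Longrightarrow> x \<in> A i \<Longrightarrow> u \<bullet> x \<le> u \<bullet> hi i"
    using ex by metis
  define P where "P j i = (if i < j then hi i else lo i)" for j i :: nat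
  define L where "L S j = (\<Sum>i\<in>S. u \<bullet> P j i)" for S j
  define V where "V S = (\<Sum>i\<in>S. A i)" for S
  define f where "f S j = measure lebesgue (V S \<inter> {x. u \<bullet> x \<le> L S j})" for S j
  define g where "g j = f T (Suc j) - f T j" for j
  obtain N where N: "T \<subseteq> {..<N}"
    using \<open>finite T\<close> finite_nat_iff_bounded by auto
  have fin: "finite S" if "S \<subseteq> T" for S
    using that \<open>finite T\<close> finite_subset by blast
  have cV: "compact (V S)" if "S \<subseteq> T" for S
    unfolding V_def using that by (intro compact_set_sum fin cmp) auto
  have lmV: "V S \<inter> {x. u \<bullet> x \<le> c} \<in> lmeasurable" if "S \<subseteq> T" for S c
    by (rule lmeasurable_Int_halfspace[OF cV[OF that]])
  have P_in: "P j i \<in> A i" if "i \<in> T" for i j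
    using lo hi that by (simp add: P_def)
  have L_stationary: "L S (Suc j) = L S j" if "j \<notin> S" for S j
    unfolding L_def P_def using that by (intro sum.cong refl) (auto simp: less_Suc_eq)
  have L_mono: "L S j \<le> L S (Suc j)" if "S \<subseteq> T" for S j
    unfolding L_def P_def using that lo_le[OF _ hi] by (intro sum_mono) auto
  have V_bounds: "L S 0 \<le> u \<bullet> x \<and> u \<bullet> x \<le> L S N" if S: "S \<subseteq> T" and x: "x \<in> V S" for S x
  proof -
    obtain s where s: "x = sum s S" "\<forall>i\<in>S. s i \<in> A i"
      using x by (auto simp: V_def set_sum_alt[OF fin[OF S]])
    have "L S 0 \<le> (\<Sum>i\<in>S. u \<bullet> s i)"
      unfolding L_def P_def using S s lo_le by (intro sum_mono) auto
    moreover have "(\<Sum>i\<in>S. u \<bullet> s i) \<le> L S N"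
      unfolding L_def P_def using S s le_hi N by (intro sum_mono) auto
    ultimately show ?thesis by (simp add: s inner_sum_right)
  qed
  \<comment> \<open>Slab volumes as increments of \<open>f\<close>: the total volume then telescopes.\<close>
  have slab: "f S (Suc j) - f S j =
      measure lebesgue (V S \<inter> {x. L S j < u \<bullet> x \<and> u \<bullet> x \<le> L S (Suc j)})"
    if S: "S \<subseteq> T" for S j
  proof -
    have "V S \<inter> {x. L S j < u \<bullet> x \<and> u \<bullet> x \<le> L S (Suc j)} =
        V S \<inter> {x. u \<bullet> x \<le> L S (Suc j)} - V S \<inter> {x. u \<bullet> x \<le> L S j}" by auto
    also have "measure lebesgue \<dots> = f S (Suc j) - f S j"
      unfolding f_def using L_mono[OF S, of j]
      by (intro measurable_measure_Diff lmV[OF S] fmeasurableD) auto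
    finally show ?thesis by simp
  qed
  have vol: "measure lebesgue (V S) = (\<Sum>j\<in>S. f S (Suc j) - f S j)" if S: "S \<subseteq> T" for S
  proof -
    have "V S \<inter> {x. u \<bullet> x \<le> L S 0} \<subseteq> {x. u \<bullet> x = L S 0}"
      using V_bounds[OF S] by force
    \<comment> \<open>The lowest slab is open from below; the hyperplane that it misses is null.\<close>
    then have "f S 0 = 0"
      unfolding f_def using negligible_hyperplane[of u "L S 0"] u
      by (metis negligible_imp_measure0 negligible_subset)
    moreover have "f S N = measure lebesgue (V S)"
      unfolding f_def using V_bounds[OF S] by (intro arg_cong[where f = "measure lebesgue"]) auto
    moreover have "(\<Sum>j<N. f S (Suc j) - f S j) = f S N - f S 0"
      by (rule sum_lessThan_telescope)
    \<comment> \<open>Slabs of indices outside \<open>S\<close> have thickness 0.\<close>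
    moreover have "(\<Sum>j<N. f S (Suc j) - f S j) = (\<Sum>j\<in>S. f S (Suc j) - f S j)"
      using S N by (intro sum.mono_neutral_right) (auto simp: f_def L_stationary)
    ultimately show ?thesis by simp
  qed
  have slab_le: "f S (Suc j) - f S j \<le> g j" if S: "S \<subseteq> T" and j: "j \<in> S" for S j
  proof -
    define w where "w = (\<Sum>i\<in>T-S. P j i)"
    have split: "L T k = L S k + L (T - S) k" for k
      unfolding L_def using sum.subset_diff[OF S \<open>finite T\<close>] by (metis add.commute)
    have uw: "u \<bullet> w = L (T - S) j"
      by (simp add: w_def L_def inner_sum_right)
    \<comment> \<open>Since \<open>j\<close> is not in \<open>T - S\<close>, one translation fits both faces of the slab.\<close>
    have stat: "L (T - S) (Suc j) = L (T - S) j"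
      using j by (intro L_stationary) auto
    have wV: "w \<in> V (T - S)"
      unfolding w_def V_def using P_in \<open>finite T\<close> by (subst set_sum_alt) auto
    have VT: "V T = V (T - S) + V S"
      unfolding V_def by (rule sum.subset_diff[OF S \<open>finite T\<close>])
    have sub: "(+) w ` (V S \<inter> {x. L S j < u \<bullet> x \<and> u \<bullet> x \<le> L S (Suc j)})
      \<subseteq> V T \<inter> {x. L T j < u \<bullet> x \<and> u \<bullet> x \<le> L T (Suc j)}"
      using wV by (auto simp: VT split uw stat inner_add_right intro: set_plus_intro)
    have lm: "V R \<inter> {x. L R j < u \<bullet> x \<and> u \<bullet> x \<le> L R (Suc j)} \<in> lmeasurable"
      if "R \<subseteq> T" for R
    proof -
      have "V R \<inter> {x. L R j < u \<bullet> x \<and> u \<bullet> x \<le> L R (Suc j)} =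
        V R \<inter> {x. u \<bullet> x \<le> L R (Suc j)} - V R \<inter> {x. u \<bullet> x \<le> L R j}" by auto
      then show ?thesis using lmV[OF that] by (simp add: fmeasurable.Diff)
    qed
    have "measure lebesgue ((+) w ` (V S \<inter> {x. L S j < u \<bullet> x \<and> u \<bullet> x \<le> L S (Suc j)}))
      \<le> measure lebesgue (V T \<inter> {x. L T j < u \<bullet> x \<and> u \<bullet> x \<le> L T (Suc j)})"
      by (intro measure_mono_fmeasurable sub lm fmeasurableD measurable_translation) (use S in auto)
    then show ?thesis
      by (simp add: g_def slab[OF S] slab[OF subset_refl] measure_translation)
  qed
  have "(\<Sum>j\<in>T. g j) = measure lebesgue (V T)"
    by (simp add: vol g_def)
  moreover have "measure lebesgue (V S) \<le> (\<Sum>j\<in>S. g j)" if "S \<subseteq> T" for S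
    unfolding vol[OF that] using slab_le[OF that] by (intro sum_mono)
  ultimately show ?thesis by (auto simp: V_def)
qed

lemma sumset_volume_eq:
  assumes "S \<subseteq> {1..M}"
  shows "sumset_volume M A S = measure lebesgue (\<Sum>i\<in>S. A i)"
  using assms by (simp add: sumset_volume_def)

lemma sumset_volume_in_set_functions: "sumset_volume M A \<in> set_functions M"
  by (auto simp: sumset_volume_def set_functions_def)

lemma lyusternik_region_subset_Gamma_FSA: "lyusternik_region TYPE('n::finite) M \<subseteq> Gamma_FSA M"
proof
  fix v assume "v \<in> lyusternik_region TYPE('n) M"
  then obtain A :: "nat \<Rightarrow> (real ^ 'n) set" where v: "v = sumset_volume M A"
    and A: "\<forall>i\<in>{1..M}. compact (A i) \<and> A i \<noteq> {}"
    by (auto simp: lyusternik_region_def)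
  have "fractionally_superadditive M v"
  proof (rule fractionally_superadditive_if_cores)
    fix T assume T: "T \<subseteq> {1..M}"
    then have "finite T" using finite_subset by blast
    then obtain g where g: "(\<Sum>j\<in>T. g j) = measure lebesgue (\<Sum>i\<in>T. A i)"
        "\<forall>S\<subseteq>T. measure lebesgue (\<Sum>i\<in>S. A i) \<le> (\<Sum>j\<in>S. g j)"
      using Minkowski_sum_core[of T A] A T by blast
    have "v S = measure lebesgue (\<Sum>i\<in>S. A i)" if "S \<subseteq> T" for S
      unfolding v using that T by (intro sumset_volume_eq) auto
    with g show "\<exists>g. sum g T = v T \<and> (\<forall>S\<subseteq>T. v S \<le> sum g S)"
      by (intro exI[of _ g]) auto
  qed
  then show "v \<in> Gamma_FSA M"
    using sumset_volume_in_set_functions[of M A]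
    by (simp add: Gamma_FSA_def v sumset_volume_def)
qed

section \<open>A supermodular function that is not a sumset volume\<close>

text \<open>
  Take two distinct points \<open>p\<close>, \<open>q\<close> of \<open>B\<close> and cut \<open>A\<close> orthogonally to \<open>q - p\<close>. Shifting the lower
  part by \<open>p\<close> and the upper part by \<open>q\<close> opens a gap of thickness \<open>\<delta>\<close> between them, so
  the two parts may overlap in a strip of thickness \<open>\<delta>\<close> before the shift and still be disjoint after it.
  The sumset therefore gains at least the volume of that strip, and some
  strip of \<open>A\<close> is not null because countably many of them cover \<open>A\<close>.
\<close>

lemma measure_set_plus_gt:
  fixes A B :: "'a::euclidean_space set"
  assumes A: "compact A" and B: "compact B" and pos: "measure lebesgue A > 0"
    and p: "p \<in> B" and q: "q \<in> B" and "p \<noteq> q"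
  shows "measure lebesgue A < measure lebesgue (A + B)"
proof -
  define u where "u = q - p"
  define \<delta> where "\<delta> = u \<bullet> q - u \<bullet> p"
  have \<delta>: "\<delta> > 0"
    using \<open>p \<noteq> q\<close> by (simp add: \<delta>_def u_def flip: inner_diff_right)
  define strip where "strip n = A \<inter> {x. (of_int n - 1) * \<delta> < u \<bullet> x \<and> u \<bullet> x \<le> of_int n * \<delta>}"
    for n :: int
  have le: "A \<inter> {x. u \<bullet> x \<le> c} \<in> lmeasurable" for c
    by (rule lmeasurable_Int_halfspace[OF A])
  have gt: "A \<inter> {x. c < u \<bullet> x} \<in> lmeasurable" for c
  proof -
    have "A \<inter> {x. c < u \<bullet> x} = A - A \<inter> {x. u \<bullet> x \<le> c}" by auto
    then show ?thesis using le lmeasurable_compact[OF A] by (simp add: fmeasurable.Diff)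
  qed
  have strip_lm: "strip n \<in> lmeasurable" for n
  proof -
    have "strip n = A \<inter> {x. u \<bullet> x \<le> of_int n * \<delta>} - A \<inter> {x. u \<bullet> x \<le> (of_int n - 1) * \<delta>}"
      by (auto simp: strip_def)
    then show ?thesis using le by (simp add: fmeasurable.Diff)
  qed
  have "\<exists>n. measure lebesgue (strip n) \<noteq> 0"
  proof (rule ccontr)
    assume "\<nexists>n. measure lebesgue (strip n) \<noteq> 0"
    then have "strip n \<in> null_sets lebesgue" for n
      using strip_lm[of n] negligible_iff_measure[of "strip n"]
      by (simp add: negligible_iff_null_sets)
    then have "(\<Union>n. strip n) \<in> null_sets lebesgue" by (rule null_sets_UN)
    moreover have "A \<subseteq> (\<Union>n. strip n)"
    proof
      fix x assume "x \<in> A"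
      define n where "n = \<lceil>u \<bullet> x / \<delta>\<rceil>"
      have "of_int n - 1 < u \<bullet> x / \<delta>" "u \<bullet> x / \<delta> \<le> of_int n"
        unfolding n_def by linarith+
      then have "x \<in> strip n"
        using \<open>x \<in> A\<close> \<delta> by (simp add: strip_def pos_less_divide_eq pos_divide_le_eq)
      then show "x \<in> (\<Union>n. strip n)" by blast
    qed
    ultimately have "negligible A"
      by (metis negligible_iff_null_sets negligible_subset)
    then show False using pos by (simp add: negligible_imp_measure0)
  qed
  then obtain n where n: "measure lebesgue (strip n) > 0"
    using zero_less_measure_iff by blast
  define c where "c = of_int n * \<delta>"
  define X where "X = A \<inter> {x. u \<bullet> x \<le> c}"
  define Y where "Y = A \<inter> {x. c - \<delta> < u \<bullet> x}"
  have X: "X \<in> lmeasurable" and Y: "Y \<in> lmeasurable"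
    using le gt by (auto simp: X_def Y_def)
  have "measure lebesgue A + measure lebesgue (strip n) = measure lebesgue X + measure lebesgue Y"
  proof -
    have "X \<union> Y = A" "X \<inter> Y = strip n"
      using \<delta> by (auto simp: X_def Y_def strip_def c_def algebra_simps)
    then show ?thesis
      using measure_Un3[OF X Y] by simp
  qed
  also have "\<dots> = measure lebesgue ((+) p ` X) + measure lebesgue ((+) q ` Y)"
    by (simp add: measure_translation)
  also have "\<dots> = measure lebesgue ((+) p ` X \<union> (+) q ` Y)"
  proof -
    have "u \<bullet> x \<le> c + u \<bullet> p" if "x \<in> (+) p ` X" for x
      using that by (auto simp: X_def inner_add_right)
    moreover have "c + u \<bullet> p < u \<bullet> x" if "x \<in> (+) q ` Y" for x
      using that by (auto simp: Y_def \<delta>_def inner_add_right)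
    ultimately have "(+) p ` X \<inter> (+) q ` Y = {}" by fastforce
    then show ?thesis
      using measure_Un3[OF measurable_translation[OF X] measurable_translation[OF Y], of p q]
      by simp
  qed
  also have "\<dots> \<le> measure lebesgue (A + B)"
  proof (rule measure_mono_fmeasurable)
    show "(+) p ` X \<union> (+) q ` Y \<subseteq> A + B"
      using p q by (auto simp: X_def Y_def add.commute[of p] add.commute[of q] intro: set_plus_intro)
    show "(+) p ` X \<union> (+) q ` Y \<in> sets lebesgue"
      by (intro sets.Un fmeasurableD measurable_translation X Y)
    show "A + B \<in> lmeasurable"
      by (intro lmeasurable_compact compact_set_plus A B)
  qed
  finally show ?thesis using n by simp
qed

definition dictator_plus_pair :: "nat \<Rightarrow> nat set \<Rightarrow> real" where
  "dictator_plus_pair M = (\<lambda>S\<in>Pow {1..M}. of_bool (1 \<in> S) + of_bool ({2, 3} \<subseteq> S))"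

lemma dictator_plus_pair_eq:
  "S \<subseteq> {1..M} \<Longrightarrow> dictator_plus_pair M S = of_bool (1 \<in> S) + of_bool ({2, 3} \<subseteq> S)"
  by (simp add: dictator_plus_pair_def)

lemma dictator_plus_pair_in_set_functions: "dictator_plus_pair M \<in> set_functions M"
  by (auto simp: dictator_plus_pair_def set_functions_def)

lemma dictator_plus_pair_in_Gamma_SM: "dictator_plus_pair M \<in> Gamma_SM M"
proof -
  have "supermodular M (dictator_plus_pair M)"
    unfolding supermodular_def
  proof (intro allI impI)
    fix S T assume "S \<subseteq> {1..M}" "T \<subseteq> {1..M}"
    moreover from this have "S \<union> T \<subseteq> {1..M}" "S \<inter> T \<subseteq> {1..M}" by auto
    ultimately show "dictator_plus_pair M S + dictator_plus_pair M T
        \<le> dictator_plus_pair M (S \<union> T) + dictator_plus_pair M (S \<inter> T)"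
      by (auto simp: dictator_plus_pair_eq)
  qed
  then show ?thesis
    using dictator_plus_pair_in_set_functions by (simp add: Gamma_SM_def dictator_plus_pair_eq)
qed

lemma dictator_plus_pair_in_Gamma_FSA: "dictator_plus_pair M \<in> Gamma_FSA M"
proof -
  have "fractionally_superadditive M (dictator_plus_pair M)"
  proof (rule fractionally_superadditive_if_cores)
    fix T assume T: "T \<subseteq> {1..M}"
    \<comment> \<open>The pair \<open>{2, 3}\<close> pays its unit entirely to 2.\<close>
    define g :: "nat \<Rightarrow> real" where
      "g j = of_bool (j = 1) + (if j = 2 then of_bool (3 \<in> T) else 0)" for j
    have g: "sum g S = of_bool (1 \<in> S) + of_bool (2 \<in> S \<and> 3 \<in> T)" if "S \<subseteq> T" for S
    proof -
      have "finite S" using that T by (meson finite_atLeastAtMost finite_subset)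
      then show ?thesis by (simp add: g_def sum.distrib of_bool_def)
    qed
    have "sum g T = dictator_plus_pair M T"
      using T by (simp add: g dictator_plus_pair_eq)
    moreover have "dictator_plus_pair M S \<le> sum g S" if "S \<subseteq> T" for S
      using that T by (auto simp: g dictator_plus_pair_eq)
    ultimately show "\<exists>g. sum g T = dictator_plus_pair M T \<and>
        (\<forall>S\<subseteq>T. dictator_plus_pair M S \<le> sum g S)" by blast
  qed
  then show ?thesis
    using dictator_plus_pair_in_set_functions by (simp add: Gamma_FSA_def dictator_plus_pair_eq)
qed

lemma dictator_plus_pair_notin_lyusternik_region:
  assumes "M \<ge> 3"
  shows "dictator_plus_pair M \<notin> lyusternik_region TYPE('n::finite) M"
proof
  assume "dictator_plus_pair M \<in> lyusternik_region TYPE('n) M"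
  then obtain A :: "nat \<Rightarrow> (real ^ 'n) set" where v: "dictator_plus_pair M = sumset_volume M A"
    and A: "\<And>i. i \<in> {1..M} \<Longrightarrow> compact (A i) \<and> A i \<noteq> {}"
    by (auto simp: lyusternik_region_def)
  have vol: "measure lebesgue (\<Sum>i\<in>S. A i) = of_bool (1 \<in> S) + of_bool ({2, 3} \<subseteq> S)"
    if "S \<subseteq> {1..M}" for S
    using sumset_volume_eq[OF that, of A] dictator_plus_pair_eq[OF that] v by simp
  have A1: "measure lebesgue (A 1) = 1" and A12: "measure lebesgue (A 1 + A 2) = 1"
    and A3: "measure lebesgue (A 3) = 0" and A23: "measure lebesgue (A 2 + A 3) = 1"
    using vol[of "{1}"] vol[of "{1, 2}"] vol[of "{3}"] vol[of "{2, 3}"] assms by simp_all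
  obtain p where p: "p \<in> A 2" using A[of 2] assms by auto
  have "q = p" if "q \<in> A 2" for q
    using measure_set_plus_gt[of "A 1" "A 2" p q] A[of 1] A[of 2] A1 A12 p that assms by auto
  then have "A 2 = {p}" using p by blast
  then have "A 2 + A 3 = (+) p ` A 3"
    by (auto simp: set_plus_def)
  then show False
    using A3 A23 by (simp add: measure_translation)
qed

section \<open>A sumset volume that is not supermodular\<close>

lemma measure_box_cart_axis:
  fixes k :: "'n::finite"
  assumes "c \<ge> 0"
  shows "measure lebesgue (cbox 0 (\<chi> i. if i = k then c else 1)) = c"
proof -
  have "(\<Prod>i\<in>UNIV. if i = k then c else 1) = c"
    by (simp add: prod.delta)
  then show ?thesis
    using assms by (simp add: measure_completion content_cbox_cart interval_ne_empty_cart)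
qed

text \<open>
  The first set consists of two opposite facets of the unit cube, the others are unit
  segments orthogonal to these facets. One segment sweeps the facets over a box of length 2, two
  segments over a box of length 3, and the facets alone have volume 0.
\<close>

lemma lyusternik_region_not_supermodular:
  assumes "M \<ge> 3"
  shows "\<not> lyusternik_region TYPE('n::finite) M \<subseteq> Gamma_SM M"
proof
  assume sub: "lyusternik_region TYPE('n) M \<subseteq> Gamma_SM M"
  define k :: 'n where "k = undefined"
  define Q :: "real \<Rightarrow> (real ^ 'n) set" where "Q c = cbox 0 (\<chi> i. if i = k then c else 1)" for c
  define plates :: "(real ^ 'n) set" where "plates = Q 1 \<inter> ({x. x $ k = 0} \<union> {x. x $ k = 1})"
  define segment :: "(real ^ 'n) set" where "segment = cbox 0 (axis k 1)"
  define A where "A i = (if i = 1 then plates else segment)" for i :: nat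
  have Q: "x \<in> Q c \<longleftrightarrow> 0 \<le> x $ k \<and> x $ k \<le> c \<and> (\<forall>i. i \<noteq> k \<longrightarrow> 0 \<le> x $ i \<and> x $ i \<le> 1)" for x c
    by (auto simp: Q_def mem_box_cart)
  have seg: "x \<in> segment \<longleftrightarrow> 0 \<le> x $ k \<and> x $ k \<le> 1 \<and> (\<forall>i. i \<noteq> k \<longrightarrow> x $ i = 0)" for x
    by (auto simp: segment_def mem_box_cart axis_def order_antisym)
  have "compact plates"
    unfolding plates_def Q_def
    by (intro compact_Int_closed compact_cbox closed_Un closed_Collect_eq continuous_intros)
  moreover have "compact segment" by (simp add: segment_def)
  moreover have "0 \<in> plates" "0 \<in> segment" by (simp_all add: plates_def Q seg)
  ultimately have "\<forall>i\<in>{1..M}. compact (A i) \<and> A i \<noteq> {}"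
    by (auto simp: A_def)
  then have "sumset_volume M A \<in> Gamma_SM M"
    using sub by (auto simp: lyusternik_region_def)
  then have "supermodular M (sumset_volume M A)"
    by (simp add: Gamma_SM_def)
  moreover have "{1, 2} \<subseteq> {1..M}" "{1, 3} \<subseteq> {1..M}" using assms by auto
  ultimately have "sumset_volume M A ({1, 2} \<union> {1, 3}) + sumset_volume M A ({1, 2} \<inter> {1, 3})
      \<ge> sumset_volume M A {1, 2} + sumset_volume M A {1, 3}"
    unfolding supermodular_def by blast
  moreover have "{1, 2} \<union> {1, 3} = {1, 2, 3 :: nat}" "{1, 2} \<inter> {1, 3} = {1 :: nat}" by auto
  ultimately have ineq: "measure lebesgue (plates + (segment + segment)) + measure lebesgue plates
      \<ge> 2 * measure lebesgue (plates + segment)"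
    using assms by (simp add: sumset_volume_eq A_def)
  have "plates \<subseteq> {x. x $ k = 0} \<union> {x. x $ k = 1}" by (auto simp: plates_def)
  moreover have "negligible {x :: real ^ 'n. x $ k = c}" for c
    using negligible_hyperplane[of "axis k 1 :: real ^ 'n" c] by (simp add: inner_axis')
  ultimately have plates0: "measure lebesgue plates = 0"
    by (metis negligible_Un negligible_imp_measure0 negligible_subset)
  have "plates + (segment + segment) \<subseteq> Q 3"
  proof
    fix x assume "x \<in> plates + (segment + segment)"
    then obtain a b c where "x = a + (b + c)" "a \<in> plates" "b \<in> segment" "c \<in> segment"
      by (auto elim!: set_plus_elim)
    then show "x \<in> Q 3" by (auto simp: plates_def Q seg)
  qed
  then have upper: "measure lebesgue (plates + (segment + segment)) \<le> 3"
    using measure_mono_fmeasurable[of "plates + (segment + segment)" "Q 3" lebesgue]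
      measure_box_cart_axis[of 3 k] \<open>compact plates\<close> \<open>compact segment\<close>
    by (simp add: Q_def lmeasurable_compact compact_set_plus fmeasurableD)
  have "Q 2 \<subseteq> plates + segment"
  proof
    fix x assume x: "x \<in> Q 2"
    \<comment> \<open>Lower half of the box: start from the facet at height 0; upper half: from the one at 1.\<close>
    define t where "t = (if x $ k \<le> 1 then x $ k else x $ k - 1)"
    have "axis k t \<in> segment" "x - axis k t \<in> plates"
      using x by (auto simp: t_def seg plates_def Q axis_def)
    then show "x \<in> plates + segment"
      using set_plus_intro[of "x - axis k t" plates "axis k t" segment] by simp
  qed
  then have lower: "measure lebesgue (plates + segment) \<ge> 2"
    using measure_mono_fmeasurable[of "Q 2" "plates + segment" lebesgue]
      measure_box_cart_axis[of 2 k] \<open>compact plates\<close> \<open>compact segment\<close>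
    by (simp add: Q_def lmeasurable_compact compact_set_plus)
  show False using ineq plates0 upper lower by linarith
qed

section \<open>The regions compared\<close>

lemma zero_in_lyusternik_region_Int_Gamma_SM:
  "(\<lambda>S\<in>Pow {1..M}. 0) \<in> lyusternik_region TYPE('n::finite) M \<inter> Gamma_SM M"
proof -
  have "(\<Sum>i\<in>S. {0 :: real ^ 'n}) = {0}" for S :: "nat set"
    by (simp flip: set_zero)
  then have "(\<lambda>S\<in>Pow {1..M}. 0) = sumset_volume M (\<lambda>i. {0 :: real ^ 'n})"
    by (auto simp: sumset_volume_def)
  then have "(\<lambda>S\<in>Pow {1..M}. 0) \<in> lyusternik_region TYPE('n) M"
    by (auto simp: lyusternik_region_def)
  moreover have "(\<lambda>S\<in>Pow {1..M}. 0) \<in> Gamma_SM M"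
    by (auto simp: Gamma_SM_def set_functions_def supermodular_def)
  ultimately show ?thesis by blast
qed

theorem theorem1:
  fixes M :: nat
  assumes "M \<ge> 3"
  shows "lyusternik_region TYPE('n::finite) M \<subset> Gamma_FSA M \<and>
         lyusternik_region TYPE('n) M \<inter> Gamma_SM M \<noteq> {} \<and>
         \<not> lyusternik_region TYPE('n) M \<subseteq> Gamma_SM M \<and>
         \<not> Gamma_SM M \<subseteq> lyusternik_region TYPE('n) M"
  using lyusternik_region_subset_Gamma_FSA[where 'n = 'n]
    zero_in_lyusternik_region_Int_Gamma_SM[where 'n = 'n]
    lyusternik_region_not_supermodular[OF assms, where 'n = 'n]
    dictator_plus_pair_notin_lyusternik_region[OF assms, where 'n = 'n]
    dictator_plus_pair_in_Gamma_SM dictator_plus_pair_in_Gamma_FSA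
  by blast

end
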